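(* Let $L,f:[a,b]\times\mathbb{R}\times\mathbb{R}\to\mathbb{R}$, $(t,x,u)\mapsto L(t,x,u)$, $f(t,x,u)$, be continuously differentiable in all three arguments and let $x_a\in\mathbb{R}$. Consider the problem (BP) of maximizing $$J[x(\cdot),u(\cdot)]=\int_a^b L(t,x(t),u(t))\,dt$$ over all pairs $(x,u)$ with $x\in PC^1$, $u\in PC$, satisfying $${}^{C}\mathbb{D}^{\psi(\cdot)}_{a^+}x(t)=f(t,x(t),u(t)),\quad t\in[a,b],\qquad x(a)=x_a .$$ If the functions $(x,u)\mapsto L(t,x,u)$ and $(x,u)\mapsto f(t,x,u)$ are concave (for each $t\in[a,b]$) and $(\tilde x,\tilde u,\lambda)$ is a Pontryagin extremal of (BP) with $\lambda(t)\ge 0$ for $t\in[a,b]$, then $$J[\tilde x,\tilde u]\ge J[x,u]$$ for every admissible pair $(x,u)$.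
   Context: Let $a<b$ be real numbers. $PC$ denotes the piecewise continuous functions $[a,b]\to\mathbb{R}$ and $PC^1$ the piecewise smooth functions $[a,b]\to\mathbb{R}$ (continuous, with piecewise continuous derivative). $\psi:[0,1]\to\mathbb{R}$ is a fixed non-negative continuous function with $\int_0^1\psi(\alpha)\,d\alpha>0$ (the distribution of the orders of differentiation). Riemann--Liouville fractional integrals of order $\beta>0$: $I^{\beta}_{a^+}x(t)=\frac{1}{\Gamma(\beta)}\int_a^t(t-s)^{\beta-1}x(s)\,ds$ and $I^{\beta}_{b^-}x(t)=\frac{1}{\Gamma(\beta)}\int_t^b(s-t)^{\beta-1}x(s)\,ds$. For $\alpha\in(0,1)$, the right Riemann--Liouville derivative is $D^\alpha_{b^-}x(t)=-\frac{d}{dt}I^{1-\alpha}_{b^-}x(t)$, and the left Caputo derivative is ${}^{C}D^\alpha_{a^+}x(t)=\frac{d}{dt}I^{1-\alpha}_{a^+}(x-x(a))(t)$, equal to $I^{1-\alpha}_{a^+}x'(t)$ for $x$ piecewise smooth. (The endpoint orders $\alpha=0,1$ do not affect the integrals below.) Distributed-order operators: $${}^{C}\mathbb{D}^{\psi(\cdot)}_{a^+}x(t)=\int_0^1\psi(\alpha)\,{}^{C}D^\alpha_{a^+}x(t)\,d\alpha,\quad \mathbb{D}^{\psi(\cdot)}_{b^-}x(t)=\int_0^1\psi(\alpha)\,D^\alpha_{b^-}x(t)\,d\alpha,\quad \mathbb{I}^{1-\psi(\cdot)}_{b^-}x(t)=\int_0^1\psi(\alpha)\,I^{1-\alpha}_{b^-}x(t)\,d\alpha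 .$$ A pair $(x,u)$ is admissible if it satisfies all the constraints of (BP). A triple $(\tilde x,\tilde u,\lambda)$ is a Pontryagin extremal of (BP) if $(\tilde x,\tilde u)$ is admissible, $\lambda\in PC^1$, and for all $t\in[a,b]$: $$\frac{\partial L}{\partial u}(t,\tilde x(t),\tilde u(t))+\lambda(t)\frac{\partial f}{\partial u}(t,\tilde x(t),\tilde u(t))=0,$$ $$\mathbb{D}^{\psi(\cdot)}_{b^-}\lambda(t)=\frac{\partial L}{\partial x}(t,\tilde x(t),\tilde u(t))+\lambda(t)\frac{\partial f}{\partial x}(t,\tilde x(t),\tilde u(t)),$$ and $\mathbb{I}^{1-\psi(\cdot)}_{b^-}\lambda(b)=0$. *)

theory Defs
  imports "HOL-Analysis.Analysis"
begin

text \<open>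
  Finitely many discontinuities, all of them jumps: the one-sided limits exist (as real numbers).
  The value at a jump is unconstrained. The library's \<open>piecewise_C1_differentiable_on\<close> is not used
  below, because it puts no condition on the derivative near the exceptional points and so admits,
  for instance, \<open>sqrt\<close> on \<open>[0,1]\<close>.
\<close>

definition PC :: "real \<Rightarrow> real \<Rightarrow> (real \<Rightarrow> real) set" where
  "PC a b = {g.
     (\<exists>S. finite S \<and> continuous_on ({a..b} - S) g) \<and>
     (\<forall>t\<in>{a..<b}. \<exists>l. (g \<longlongrightarrow> l) (at_right t)) \<and>
     (\<forall>t\<in>{a<..b}. \<exists>l. (g \<longlongrightarrow> l) (at_left t))}"

definition PC1 :: "real \<Rightarrow> real \<Rightarrow> (real \<Rightarrow> real) set" where
  "PC1 a b = {x. continuous_on {a..b} x \<and>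
     (\<exists>g\<in>PC a b. \<exists>S. finite S \<and>
        (\<forall>t\<in>{a..b} - S. (x has_real_derivative g t) (at t within {a..b})))}"

definition continuously_differentiable_on ::
    "('a::real_normed_vector \<Rightarrow> 'b::real_normed_vector) \<Rightarrow> 'a set \<Rightarrow> bool" where
  "continuously_differentiable_on g S \<longleftrightarrow>
     (\<exists>g'. (\<forall>p\<in>S. (g has_derivative blinfun_apply (g' p)) (at p within S)) \<and> continuous_on S g')"

definition RL_integral_left :: "real \<Rightarrow> real \<Rightarrow> (real \<Rightarrow> real) \<Rightarrow> real \<Rightarrow> real" where
  "RL_integral_left a \<beta> x t = 1 / Gamma \<beta> * (LBINT s=a..t. (t - s) powr (\<beta> - 1) * x s)"

definition RL_integral_right :: "real \<Rightarrow> real \<Rightarrow> (real \<Rightarrow> real) \<Rightarrow> real \<Rightarrow> real" where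
  "RL_integral_right b \<beta> x t = 1 / Gamma \<beta> * (LBINT s=t..b. (s - t) powr (\<beta> - 1) * x s)"

text \<open>
  Derivatives are taken within \<open>[a,b]\<close>, hence one-sided at the endpoints, so that only the
  values of \<open>x\<close> on \<open>[a,b]\<close> matter.
\<close>

definition Caputo_deriv_left ::
    "real \<Rightarrow> real \<Rightarrow> real \<Rightarrow> (real \<Rightarrow> real) \<Rightarrow> real \<Rightarrow> real" where
  "Caputo_deriv_left a b \<alpha> x t =
     vector_derivative (RL_integral_left a (1 - \<alpha>) (\<lambda>s. x s - x a)) (at t within {a..b})"

definition RL_deriv_right ::
    "real \<Rightarrow> real \<Rightarrow> real \<Rightarrow> (real \<Rightarrow> real) \<Rightarrow> real \<Rightarrow> real" where
  "RL_deriv_right a b \<alpha> x t =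
     - vector_derivative (RL_integral_right b (1 - \<alpha>) x) (at t within {a..b})"

text \<open>
  The interval integral \<open>LBINT \<alpha>=0..1\<close> ranges over the open interval, so the orders
  \<open>\<alpha> = 0\<close> and \<open>\<alpha> = 1\<close> play no role.
\<close>

definition distributed_Caputo_left ::
    "real \<Rightarrow> real \<Rightarrow> (real \<Rightarrow> real) \<Rightarrow> (real \<Rightarrow> real) \<Rightarrow> real \<Rightarrow> real" where
  "distributed_Caputo_left a b \<psi> x t = (LBINT \<alpha>=0..1. \<psi> \<alpha> * Caputo_deriv_left a b \<alpha> x t)"

definition distributed_RL_right ::
    "real \<Rightarrow> real \<Rightarrow> (real \<Rightarrow> real) \<Rightarrow> (real \<Rightarrow> real) \<Rightarrow> real \<Rightarrow> real" where
  "distributed_RL_right a b \<psi> x t = (LBINT \<alpha>=0..1. \<psi> \<alpha> * RL_deriv_right a b \<alpha> x t)"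

definition distributed_RL_integral_right ::
    "real \<Rightarrow> (real \<Rightarrow> real) \<Rightarrow> (real \<Rightarrow> real) \<Rightarrow> real \<Rightarrow> real" where
  "distributed_RL_integral_right b \<psi> x t =
     (LBINT \<alpha>=0..1. \<psi> \<alpha> * RL_integral_right b (1 - \<alpha>) x t)"

definition objective ::
    "real \<Rightarrow> real \<Rightarrow> (real \<Rightarrow> real \<Rightarrow> real \<Rightarrow> real) \<Rightarrow> (real \<Rightarrow> real) \<Rightarrow> (real \<Rightarrow> real) \<Rightarrow> real" where
  "objective a b L x u = (LBINT t=a..b. L t (x t) (u t))"

definition admissible ::
    "real \<Rightarrow> real \<Rightarrow> (real \<Rightarrow> real) \<Rightarrow> (real \<Rightarrow> real \<Rightarrow> real \<Rightarrow> real) \<Rightarrow> real \<Rightarrow>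
     (real \<Rightarrow> real) \<Rightarrow> (real \<Rightarrow> real) \<Rightarrow> bool" where
  "admissible a b \<psi> f xa x u \<longleftrightarrow>
     x \<in> PC1 a b \<and> u \<in> PC a b \<and>
     (\<forall>t\<in>{a..b}. distributed_Caputo_left a b \<psi> x t = f t (x t) (u t)) \<and>
     x a = xa"

definition pontryagin_extremal ::
    "real \<Rightarrow> real \<Rightarrow> (real \<Rightarrow> real) \<Rightarrow> (real \<Rightarrow> real \<Rightarrow> real \<Rightarrow> real) \<Rightarrow>
     (real \<Rightarrow> real \<Rightarrow> real \<Rightarrow> real) \<Rightarrow> real \<Rightarrow>
     (real \<Rightarrow> real) \<Rightarrow> (real \<Rightarrow> real) \<Rightarrow> (real \<Rightarrow> real) \<Rightarrow> bool" where
  "pontryagin_extremal a b \<psi> L f xa x u lam \<longleftrightarrow>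
     admissible a b \<psi> f xa x u \<and> lam \<in> PC1 a b \<and>
     (\<forall>t\<in>{a..b}.
        deriv (\<lambda>v. L t (x t) v) (u t) + lam t * deriv (\<lambda>v. f t (x t) v) (u t) = 0) \<and>
     (\<forall>t\<in>{a..b}.
        distributed_RL_right a b \<psi> lam t =
          deriv (\<lambda>y. L t y (u t)) (x t) + lam t * deriv (\<lambda>y. f t y (u t)) (x t)) \<and>
     distributed_RL_integral_right b \<psi> lam b = 0"

end

theory Submission
  imports Defs
begin

text \<open>
  Write \<open>DC x\<close> for the left distributed Caputo derivative and \<open>DR \<lambda>\<close> for the right distributed
  Riemann-Liouville derivative. Let \<open>(x,u)\<close> be a competitor of the extremal \<open>(x~,u~,\<lambda>)\<close>.
  By concavity the increment of \<open>L\<close> is at most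
  \<open>L\<^sub>x (x - x~) + L\<^sub>u (u - u~)\<close>, derivatives being taken along the extremal. The Pontryagin conditions
  replace this bound by
  \<open>DR \<lambda> (x - x~) - \<lambda> (f\<^sub>x (x - x~) + f\<^sub>u (u - u~))\<close>. Since \<open>\<lambda> \<ge> 0\<close> and \<open>f\<close> is concave
  (\<open>concave_on_gradient_inequality\<close>), and the control system says that \<open>f\<close> is \<open>DC\<close> of the state,
  this is at most \<open>DR \<lambda> (x - x~) - \<lambda> (DC x - DC x~)\<close>. So the theorem follows from the duality
  \<open>\<integral> (x - x(a)) DR \<lambda> = \<integral> \<lambda> DC x\<close> (\<open>distributed_integration_by_parts\<close>), applied to \<open>x\<close> and to \<open>x~\<close>,
  which have the same initial value.

  The duality is obtained by turning both operators into convolutions. For \<open>x\<close> piecewise smooth,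
  \<open>DC x (t) = \<integral> K(r) x'(t - r) dr\<close> and
  \<open>DR \<lambda> (t) = \<lambda>(b) K(b - t) - \<integral> K(r) \<lambda>'(t + r) dr\<close>, where
  \<open>K(r) = \<integral>\<^sub>0\<^sup>1 \<psi>(\<alpha>) r powr (-\<alpha>) / \<Gamma>(1 - \<alpha>) d\<alpha>\<close> for \<open>0 < r < b - a\<close>, and \<open>0\<close> elsewhere, is
  an integrable kernel (\<open>integrable_distributed_kernel\<close>). For each order the derivative is computed by differentiating
  under the integral sign (\<open>has_derivative_integral_kernel\<close>), and Fubini collects the orders in \<open>K\<close>.
  Ordinary integration by parts for \<open>\<lambda>\<close> and \<open>K * (x - x(a))\<close>, and one more
  exchange of integrals (\<open>convolution_transpose\<close>), then give the duality.

  All identities are established for \<open>a < t < b\<close> only. This suffices under the integral sign, and it is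
  all one can expect: at \<open>t = b\<close> the fractional integral of \<open>\<lambda>\<close> need not be differentiable.
\<close>

section \<open>Piecewise continuous functions\<close>

text \<open>
  One-sided limits bound the function near every point, and Bolzano's bisection principle glues
  these local bounds together.
\<close>

lemma PC_bounded:
  assumes "a \<le> b" "u \<in> PC a b"
  shows "bounded (u ` {a..b})"
proof -
  have near: "\<exists>d>0. bounded (u ` ({a..b} \<inter> {x - d<..<x + d}))" if x: "a \<le> x" "x \<le> b" for x
  proof -
    have R: "\<exists>d>0. bounded (u ` ({a..b} \<inter> {x<..<x + d}))"
    proof (cases "x < b")
      case True
      then obtain l where l: "(u \<longlongrightarrow> l) (at_right x)" using assms x by (fastforce simp: PC_def)
      then have "eventually (\<lambda>s. dist (u s) l < 1) (at_right x)" by (auto simp: tendsto_iff)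
      then obtain c where "c > x" "\<forall>s>x. s < c \<longrightarrow> dist (u s) l < 1"
        by (auto simp: eventually_at_right_field)
      then show ?thesis
        unfolding bounded_def
        by (intro exI[of _ "c - x"] conjI exI[of _ l] exI[of _ "1::real"])
           (auto simp: dist_commute intro!: less_imp_le)
    next
      case False
      then have "{a..b} \<inter> {x<..<x + 1} = {}" by auto
      then show ?thesis by (intro exI[of _ 1]) (simp only: image_empty bounded_empty zero_less_one simp_thms)
    qed
    have L: "\<exists>d>0. bounded (u ` ({a..b} \<inter> {x - d<..<x}))"
    proof (cases "a < x")
      case True
      then obtain l where l: "(u \<longlongrightarrow> l) (at_left x)" using assms x by (fastforce simp: PC_def)
      then have "eventually (\<lambda>s. dist (u s) l < 1) (at_left x)" by (auto simp: tendsto_iff)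
      then obtain c where "c < x" "\<forall>s>c. s < x \<longrightarrow> dist (u s) l < 1"
        by (auto simp: eventually_at_left_field)
      then show ?thesis
        unfolding bounded_def
        by (intro exI[of _ "x - c"] conjI exI[of _ l] exI[of _ "1::real"])
           (auto simp: dist_commute intro!: less_imp_le)
    next
      case False
      then have "{a..b} \<inter> {x - 1<..<x} = {}" by auto
      then show ?thesis by (intro exI[of _ 1]) (simp only: image_empty bounded_empty zero_less_one simp_thms)
    qed
    from R obtain d where d: "d > 0" "bounded (u ` ({a..b} \<inter> {x<..<x + d}))" by auto
    from L obtain e where e: "e > 0" "bounded (u ` ({a..b} \<inter> {x - e<..<x}))" by auto
    have "bounded (u ` ({a..b} \<inter> {x<..<x + d}) \<union> u ` ({a..b} \<inter> {x - e<..<x}) \<union> {u x})"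
      using d e by simp
    moreover have "u ` ({a..b} \<inter> {x - min d e<..<x + min d e}) \<subseteq> 
        u ` ({a..b} \<inter> {x<..<x + d}) \<union> u ` ({a..b} \<inter> {x - e<..<x}) \<union> {u x}"
    proof -
      have "{a..b} \<inter> {x - min d e<..<x + min d e} \<subseteq>
          {a..b} \<inter> {x<..<x + d} \<union> {a..b} \<inter> {x - e<..<x} \<union> {x}"
      proof
        fix y assume "y \<in> {a..b} \<inter> {x - min d e<..<x + min d e}"
        then show "y \<in> {a..b} \<inter> {x<..<x + d} \<union> {a..b} \<inter> {x - e<..<x} \<union> {x}"
          by (cases y x rule: linorder_cases) auto
      qed
      from image_mono[OF this, of u] show ?thesis by (simp only: image_Un image_insert image_empty)
    qed
    ultimately have "bounded (u ` ({a..b} \<inter> {x - min d e<..<x + min d e}))"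
      by (rule bounded_subset)
    moreover have "0 < min d e" using d e by simp
    ultimately show ?thesis by blast
  qed
  have "bounded (u ` ({a..b} \<inter> {a..b}))"
    using \<open>a \<le> b\<close>
  proof (induction rule: Bolzano[where P = "\<lambda>p q. bounded (u ` ({a..b} \<inter> {p..q}))"])
    case (trans p q r)
    then have "u ` ({a..b} \<inter> {p..r}) = u ` ({a..b} \<inter> {p..q}) \<union> u ` ({a..b} \<inter> {q..r})" by force
    with trans show ?case by simp
  next
    case (local x)
    then obtain d where d: "d > 0" "bounded (u ` ({a..b} \<inter> {x - d<..<x + d}))" using near by blast
    have "bounded (u ` ({a..b} \<inter> {p..q}))" if "p \<le> x" "x \<le> q" "q - p < d" for p q
      using that by (intro bounded_subset[OF d(2)]) auto
    then show ?case using d(1) by blast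
  qed
  then show ?thesis by simp
qed

lemma borel_measurable_if_continuous_off_finite:
  fixes g :: "real \<Rightarrow> real"
  assumes "finite S" "continuous_on ({a..b} - S) g"
  shows "(\<lambda>t. indicator ({a..b} - S) t * g t) \<in> borel_measurable borel"
proof -
  have "{a..b} - S \<in> sets borel" using assms(1) by (intro sets.Diff) (auto simp: finite_imp_closed)
  then show ?thesis using borel_measurable_continuous_on_indicator[OF _ assms(2)] by simp
qed

lemma set_integrable_if_continuous_off_finite:
  fixes g :: "real \<Rightarrow> real"
  assumes S: "finite S" "continuous_on ({a..b} - S) g" and bd: "bounded (g ` {a..b})"
  shows "set_integrable lborel {a..b} g"
proof -
  obtain B where B: "\<And>t. t \<in> {a..b} \<Longrightarrow> \<bar>g t\<bar> \<le> B" using bd by (fastforce simp: bounded_iff)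
  have m: "(\<lambda>t. indicator {a..b} t * g t) \<in> borel_measurable borel"
    using borel_measurable_if_continuous_off_finite[OF S]
    by (rule measurable_discrete_difference[where X=S])
       (use S in \<open>auto simp: countable_finite indicator_def\<close>)
  have "integrable lborel (\<lambda>t. indicator {a..b} t * B)" 
    by (rule integrable_mult_left) (simp add: integrable_indicator_iff emeasure_lborel_Icc_eq)
  then show ?thesis unfolding set_integrable_def
    by (rule Bochner_Integration.integrable_bound) (use m B in \<open>fastforce simp: indicator_def\<close>)+
qed

section \<open>Piecewise smooth functions\<close>

text \<open>
  Replacing \<open>x\<close> by \<open>x \<circ> clamp_real a b\<close> freezes it at its end values outside \<open>[a,b]\<close>.
  For piecewise smooth \<open>x\<close> the result is Lipschitz and bounded on the whole line, so that the range of integration of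
  a fractional integral can be made independent of \<open>t\<close>.
\<close>

definition clamp_real :: "real \<Rightarrow> real \<Rightarrow> real \<Rightarrow> real" where
  "clamp_real a b t = max a (min b t)"

lemma clamp_real_simps [simp]:
  "t \<in> {a..b} \<Longrightarrow> clamp_real a b t = t" 
  "a \<le> b \<Longrightarrow> t \<le> a \<Longrightarrow> clamp_real a b t = a" "a \<le> b \<Longrightarrow> b \<le> t \<Longrightarrow> clamp_real a b t = b"
  "a \<le> b \<Longrightarrow> clamp_real a b t \<in> {a..b}"
  by (auto simp: clamp_real_def)

text \<open>
  The form in which \<open>PC1\<close> is used: \<open>g\<close> is a bounded Borel version of \<open>x'\<close>, extended by zero, and
  the exceptional set \<open>S\<close> also has to contain any kinks that clamping creates at \<open>a\<close> and \<open>b\<close>.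
\<close>

locale piecewise_C1 =
  fixes a b :: real and x g :: "real \<Rightarrow> real" and S :: "real set" and B :: real
  assumes ab: "a < b" and S: "finite S"
    and g_measurable [measurable]: "g \<in> borel_measurable borel" 
    and g_bound: "\<And>t. \<bar>g t\<bar> \<le> B"
    and g_outside: "\<And>t. t \<notin> {a<..<b} \<Longrightarrow> g t = 0"
    and clamped_deriv: "\<And>t. t \<notin> S \<Longrightarrow> ((\<lambda>s. x (clamp_real a b s)) has_real_derivative g t) (at t)"
    and clamped_lipschitz: "\<And>s t. \<bar>x (clamp_real a b s) - x (clamp_real a b t)\<bar> \<le> B * \<bar>s - t\<bar>"

text \<open>
  The derivative is piecewise continuous, hence bounded. The fundamental theorem of calculus, which
  tolerates finitely many exceptional points of a continuous function, turns this bound into a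
  Lipschitz constant.
\<close>

lemma PC1_imp_piecewise_C1:
  assumes ab: "a < b" and x: "x \<in> PC1 a b"
  obtains g S B where "piecewise_C1 a b x g S B"
proof -
  obtain g0 S0 where g0: "g0 \<in> PC a b" "finite S0" and cx: "continuous_on {a..b} x"
    and d0: "\<And>t. t \<in> {a..b} - S0 \<Longrightarrow> (x has_real_derivative g0 t) (at t within {a..b})"
    using x by (auto simp: PC1_def)
  obtain S1 where S1: "finite S1" "continuous_on ({a..b} - S1) g0" using g0 by (auto simp: PC_def)
  define S where "S = S0 \<union> S1 \<union> {a,b}"
  define g where "g t = indicator ({a..b} - S) t * g0 t" for t
  obtain B where B: "B > 0" "\<And>t. t \<in> {a..b} \<Longrightarrow> \<bar>g0 t\<bar> \<le> B"
    using PC_bounded[of a b g0] ab g0 by (auto simp: bounded_pos)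
  have S: "finite S" using g0 S1 by (simp add: S_def)
  have gm: "g \<in> borel_measurable borel" unfolding g_def using S S1
    by (intro borel_measurable_if_continuous_off_finite) 
       (auto simp: S_def elim: continuous_on_subset)
  have gB: "\<bar>g t\<bar> \<le> B" for t using B by (auto simp: g_def indicator_def)
  have g_out: "g t = 0" if "t \<notin> {a<..<b}" for t using that by (auto simp: g_def S_def indicator_def)
  have dx: "(x has_real_derivative g t) (at t)" if "t \<in> {a<..<b} - S" for t
  proof -
    have "g t = g0 t" using that by (simp add: g_def)
    moreover have "at t within {a..b} = at t" using that by (simp add: at_within_Icc_at)
    ultimately show ?thesis using d0[of t] that by (auto simp: S_def)
  qed
  have d: "((\<lambda>s. x (clamp_real a b s)) has_real_derivative g t) (at t)" if "t \<notin> S" for t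
  proof -
    have "t \<noteq> a" "t \<noteq> b" using that by (auto simp: S_def)
    then consider "t < a" | "t \<in> {a<..<b}" | "b < t" by fastforce
    then show ?thesis
    proof cases
      case 1
      have "((\<lambda>s. x a) has_real_derivative g t) (at t)" using g_out 1 by simp
      then show ?thesis by (rule has_field_derivative_transform_within_open[of _ _ _ "{..<a}"]) (use 1 ab in auto)
    next
      case 2
      then show ?thesis 
        by (intro has_field_derivative_transform_within_open[OF dx, of _ "{a<..<b}"]) (use that in auto)
    next
      case 3
      have "((\<lambda>s. x b) has_real_derivative g t) (at t)" using g_out 3 by simp
      then show ?thesis by (rule has_field_derivative_transform_within_open[of _ _ _ "{b<..}"]) (use 3 ab in auto)
    qed
  qed
  have lip0: "\<bar>x s - x t\<bar> \<le> B * \<bar>s - t\<bar>" if "s \<in> {a..b}" "t \<in> {a..b}" "t \<le> s" for s t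
  proof -
    have "(g has_integral (x s - x t)) {t..s}"
      by (rule fundamental_theorem_of_calculus_interior_strong[OF S])
         (use that dx cx in \<open>auto simp: has_real_derivative_iff_has_vector_derivative[symmetric] intro: continuous_on_subset\<close>)
    from has_integral_bound_real[OF _ _ this, of B "{}"] gB B that show ?thesis by auto
  qed
  then have lip1: "\<bar>x s - x t\<bar> \<le> B * \<bar>s - t\<bar>" if "s \<in> {a..b}" "t \<in> {a..b}" for s t
    using that by (cases "t \<le> s") (force simp: abs_minus_commute)+
  have "\<bar>x (clamp_real a b s) - x (clamp_real a b t)\<bar> \<le> B * \<bar>s - t\<bar>" for s t
  proof -
    have "\<bar>x (clamp_real a b s) - x (clamp_real a b t)\<bar> \<le> B * \<bar>clamp_real a b s - clamp_real a b t\<bar>"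
      using ab by (intro lip1) (auto simp: clamp_real_def)
    also have "\<dots> \<le> B * \<bar>s - t\<bar>" using B ab by (intro mult_left_mono) (auto simp: clamp_real_def)
    finally show ?thesis .
  qed
  then have "piecewise_C1 a b x g S B"
    by (intro piecewise_C1.intro ab S gm gB g_out d)
  then show ?thesis by (rule that)
qed

section \<open>Differentiation under a singular kernel\<close>

text \<open>
  Only \<open>h\<close> depends on \<open>t\<close>, so the singularity of \<open>k\<close> is never differentiated: the difference quotients
  of \<open>h\<close> are bounded by its Lipschitz constant and converge for all but finitely many \<open>r\<close>, and
  dominated convergence with the majorant \<open>B\<bar>k\<bar>\<close> yields a derivative at \<^emph>\<open>every\<close> \<open>t\<close>. The sign
  \<open>\<sigma> = -1\<close> serves the left operators and \<open>\<sigma> = 1\<close> the right ones.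
\<close>

lemma has_derivative_integral_kernel:
  fixes k h g :: "real \<Rightarrow> real"
  assumes k: "integrable lborel k" and \<sigma>: "\<sigma> \<noteq> 0"
    and h: "\<And>t. \<bar>h t\<bar> \<le> M" "\<And>s t. \<bar>h s - h t\<bar> \<le> B * \<bar>s - t\<bar>"
    and g: "g \<in> borel_measurable borel"
    and S: "finite S" "\<And>t. t \<notin> S \<Longrightarrow> (h has_real_derivative g t) (at t)"
  shows "((\<lambda>t. \<integral>r. k r * h (t + \<sigma> * r) \<partial>lborel) has_real_derivative
           (\<integral>r. k r * g (t + \<sigma> * r) \<partial>lborel)) (at t)"
  unfolding DERIV_def tendsto_at_iff_sequentially
proof (intro allI impI)
  fix X :: "nat \<Rightarrow> real"
  assume X0: "\<forall>i. X i \<in> UNIV - {0}" and X: "X \<longlonglongrightarrow> 0"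
  have km[measurable]: "k \<in> borel_measurable borel" using k by auto
  note g[measurable]
  have "continuous_on UNIV h"
  proof (rule lipschitz_on_continuous_on[of "\<bar>B\<bar>"])
    have "B * \<bar>s - t\<bar> \<le> \<bar>B\<bar> * \<bar>s - t\<bar>" for s t :: real by (intro mult_right_mono) auto
    then show "\<bar>B\<bar>-lipschitz_on UNIV h"
      using order_trans[OF h(2)] by (auto simp: lipschitz_on_def dist_real_def)
  qed
  then have hm[measurable]: "h \<in> borel_measurable borel" by (rule borel_measurable_continuous_onI)
  have hi: "integrable lborel (\<lambda>r. k r * h (s + \<sigma> * r))" for s
    by (rule Bochner_Integration.integrable_bound[OF integrable_mult_left[of M, OF k]])
       (auto simp: abs_mult intro!: mult_left_mono order_trans[OF h(1)])
  define q where "q i r = k r * ((h (t + X i + \<sigma> * r) - h (t + \<sigma> * r)) / X i)" for i r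
  have "(\<lambda>i. \<integral>r. q i r \<partial>lborel) \<longlonglongrightarrow> (\<integral>r. k r * g (t + \<sigma> * r) \<partial>lborel)"
  proof (rule integral_dominated_convergence)
    show "integrable lborel (\<lambda>r. \<bar>k r\<bar> * B)" using k by simp
    show "AE r in lborel. norm (q i r) \<le> \<bar>k r\<bar> * B" for i
    proof -
      have "\<bar>h (t + X i + \<sigma> * r) - h (t + \<sigma> * r)\<bar> / \<bar>X i\<bar> \<le> B" for r
        using h(2)[of "t + X i + \<sigma> * r" "t + \<sigma> * r"] X0 by (simp add: field_simps)
      then have "\<bar>k r\<bar> * (\<bar>h (t + X i + \<sigma> * r) - h (t + \<sigma> * r)\<bar> / \<bar>X i\<bar>) \<le> \<bar>k r\<bar> * B" for r
        by (intro mult_left_mono) auto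
      then show ?thesis by (simp add: q_def abs_mult)
    qed
    show "AE r in lborel. (\<lambda>i. q i r) \<longlonglongrightarrow> k r * g (t + \<sigma> * r)"
    proof -
      have "finite ((\<lambda>s. (s - t) / \<sigma>) ` S)" using S by simp
      then have "AE r in lborel. r \<notin> (\<lambda>s. (s - t) / \<sigma>) ` S"
        by (intro AE_not_in countable_imp_null_set_lborel countable_finite)
      then show ?thesis
      proof eventually_elim
        case (elim r)
        then have "t + \<sigma> * r \<notin> S" using \<sigma> by (force simp: image_iff)
        then have "(h has_real_derivative g (t + \<sigma> * r)) (at (t + \<sigma> * r))" using S by blast
        then have "(\<lambda>i. (h (t + \<sigma> * r + X i) - h (t + \<sigma> * r)) / X i) \<longlonglongrightarrow> g (t + \<sigma> * r)"
          using X0 X by (simp add: DERIV_def tendsto_at_iff_sequentially comp_def)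
        then show ?case unfolding q_def by (intro tendsto_intros) (simp add: algebra_simps)
      qed
    qed
  qed (auto simp: q_def)
  moreover have "(\<integral>r. q i r \<partial>lborel) = ((\<integral>r. k r * h (t + X i + \<sigma> * r) \<partial>lborel) - (\<integral>r. k r * h (t + \<sigma> * r) \<partial>lborel)) / X i" for i
  proof -
    have "(\<integral>r. q i r \<partial>lborel) = (\<integral>r. (k r * h (t + X i + \<sigma> * r) - k r * h (t + \<sigma> * r)) / X i \<partial>lborel)"
      by (simp add: q_def right_diff_distrib)
    also have "\<dots> = (\<integral>r. k r * h (t + X i + \<sigma> * r) - k r * h (t + \<sigma> * r) \<partial>lborel) / X i"
      by (rule integral_divide_zero)
    finally show ?thesis by (simp only: Bochner_Integration.integral_diff[OF hi hi])
  qed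
  ultimately show "((\<lambda>d. ((\<integral>r. k r * h (t + d + \<sigma> * r) \<partial>lborel) - (\<integral>r. k r * h (t + \<sigma> * r) \<partial>lborel)) / d) \<circ> X)
     \<longlonglongrightarrow> (\<integral>r. k r * g (t + \<sigma> * r) \<partial>lborel)"
    by (simp add: comp_def)
qed

section \<open>Fractional and distributed-order kernels\<close>

text \<open>
  The kernel of the fractional integral of order \<open>1 - \<alpha>\<close>, cut off at the length \<open>c\<close> of the time
  interval to make it integrable on the line. Writing \<open>1 / \<Gamma>\<close> as \<open>rGamma\<close> keeps it continuous in
  \<open>\<alpha>\<close> up to \<open>\<alpha> = 1\<close>, where \<open>\<Gamma>(1 - \<alpha>)\<close> has a pole.
\<close>

definition frac_kernel :: "real \<Rightarrow> real \<Rightarrow> real \<Rightarrow> real" where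
  "frac_kernel c \<alpha> r = indicator {0<..<c} r * (rGamma (1 - \<alpha>) * r powr (- \<alpha>))"

definition weighted_kernel :: "(real \<Rightarrow> real) \<Rightarrow> real \<Rightarrow> real \<Rightarrow> real \<Rightarrow> real" where
  "weighted_kernel \<psi> c \<alpha> r = indicator {0<..<1} \<alpha> * \<psi> \<alpha> * frac_kernel c \<alpha> r"

definition distributed_kernel :: "(real \<Rightarrow> real) \<Rightarrow> real \<Rightarrow> real \<Rightarrow> real" where
  "distributed_kernel \<psi> c r = (LBINT \<alpha>. weighted_kernel \<psi> c \<alpha> r)"

lemma rGamma_nonneg: "rGamma (x::real) \<ge> 0" if "x > 0"
  using that by (simp add: rGamma_inverse_Gamma Gamma_real_pos less_imp_le)

lemma frac_kernel_nonneg: "\<alpha> < 1 \<Longrightarrow> 0 \<le> frac_kernel c \<alpha> r"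
  by (auto simp: frac_kernel_def indicator_def rGamma_nonneg)

text \<open>
  The total mass stays bounded as \<open>\<alpha> \<rightarrow> 1\<close>: the factor \<open>1 / (1 - \<alpha>)\<close> from integrating the power is
  absorbed by \<open>\<Gamma>(2 - \<alpha>) = (1 - \<alpha>) \<Gamma>(1 - \<alpha>)\<close>. This uniformity makes the average over all orders an
  integrable kernel again.
\<close>

lemma has_bochner_integral_powr_truncated:
  fixes \<alpha> d :: real
  assumes "\<alpha> < 1" "0 \<le> d"
  shows "has_bochner_integral lborel (\<lambda>r. indicator {0<..<d} r * (rGamma (1 - \<alpha>) * r powr (- \<alpha>)))
           (rGamma (2 - \<alpha>) * d powr (1 - \<alpha>))" 
proof -
  have [simp]: "indicator {0<..<d} r * (rGamma (1 - \<alpha>) * r powr (- \<alpha>)) = frac_kernel d \<alpha> r" for r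
    by (simp add: frac_kernel_def)
  have "((\<lambda>r. r powr (- \<alpha>)) has_integral (d powr (- \<alpha> + 1) / (- \<alpha> + 1))) {0..d}"
    using assms by (intro has_integral_powr_from_0) auto
  then have "((\<lambda>r. rGamma (1 - \<alpha>) * r powr (- \<alpha>)) has_integral 
      rGamma (1 - \<alpha>) * (d powr (- \<alpha> + 1) / (- \<alpha> + 1))) {0..d}"
    by (rule has_integral_mult_right)
  also have "rGamma (1 - \<alpha>) * (d powr (- \<alpha> + 1) / (- \<alpha> + 1)) = rGamma (2 - \<alpha>) * d powr (1 - \<alpha>)"
  proof -
    have "rGamma (1 - \<alpha>) = (1 - \<alpha>) * rGamma (2 - \<alpha>)"
      using rGamma_plus1[of "1 - \<alpha>"] by (simp add: algebra_simps)
    then show ?thesis using assms by simp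
  qed
  finally have "((\<lambda>r. rGamma (1 - \<alpha>) * r powr (- \<alpha>)) has_integral (rGamma (2 - \<alpha>) * d powr (1 - \<alpha>))) {0<..<d}"
    using has_integral_Icc_iff_Ioo by blast
  then have "(frac_kernel d \<alpha> has_integral (rGamma (2 - \<alpha>) * d powr (1 - \<alpha>))) UNIV"
    unfolding has_integral_restrict_UNIV[symmetric, of _ _ "{0<..<d}"]
    by (rule has_integral_eq_rhs[OF has_integral_cong[THEN iffD1, rotated]])
      (auto simp: frac_kernel_def indicator_def)
  moreover have "frac_kernel d \<alpha> \<in> borel_measurable borel" unfolding frac_kernel_def by measurable
  ultimately show ?thesis using assms
    by (intro has_bochner_integral_nn_integral nn_integral_has_integral_lborel)
       (auto simp: frac_kernel_nonneg rGamma_nonneg)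
qed

lemma integrable_frac_kernel: "\<alpha> < 1 \<Longrightarrow> 0 \<le> c \<Longrightarrow> integrable lborel (frac_kernel c \<alpha>)"
  and integral_frac_kernel: "\<alpha> < 1 \<Longrightarrow> 0 \<le> c \<Longrightarrow> (LBINT r. frac_kernel c \<alpha> r) = rGamma (2 - \<alpha>) * c powr (1 - \<alpha>)"
  using has_bochner_integral_powr_truncated[of \<alpha> c] 
  by (auto simp: has_bochner_integral_iff frac_kernel_def[abs_def])

context
  fixes \<psi> :: "real \<Rightarrow> real" and c :: real
  assumes \<psi>: "continuous_on {0..1} \<psi>" and c: "0 < c"
begin

text \<open>
  On the rectangle that supports it the kernel is jointly continuous.
\<close>

lemma borel_measurable_weighted_kernel:
  "case_prod (weighted_kernel \<psi> c) \<in> borel_measurable (borel \<Otimes>\<^sub>M borel)"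
proof -
  have "continuous_on ({0<..<1} \<times> {0<..<c}) (\<lambda>(\<alpha>, r). \<psi> \<alpha> * (rGamma (1 - \<alpha>) * r powr (- \<alpha>)))"
    unfolding case_prod_beta
    by (intro continuous_intros continuous_on_compose2[OF \<psi>] continuous_on_compose2[OF continuous_on_rGamma]) auto
  then have "(\<lambda>p. indicator ({0<..<1} \<times> {0<..<c}) p *\<^sub>R (case p of (\<alpha>, r) \<Rightarrow> \<psi> \<alpha> * (rGamma (1 - \<alpha>) * r powr (- \<alpha>))))
     \<in> borel_measurable borel"
    by (intro borel_measurable_continuous_on_indicator) (auto intro!: borel_open open_Times)
  also have "(\<lambda>p. indicator ({0<..<1} \<times> {0<..<c}) p *\<^sub>R (case p of (\<alpha>, r) \<Rightarrow> \<psi> \<alpha> * (rGamma (1 - \<alpha>) * r powr (- \<alpha>)))) = case_prod (weighted_kernel \<psi> c)"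
    by (auto simp: fun_eq_iff weighted_kernel_def frac_kernel_def indicator_def)
  finally show ?thesis by (simp add: borel_prod)
qed

lemma integrable_weighted_kernel:
  "integrable (lborel \<Otimes>\<^sub>M lborel) (case_prod (weighted_kernel \<psi> c))"
proof (rule lborel_pair.Fubini_integrable)
  show "case_prod (weighted_kernel \<psi> c) \<in> borel_measurable (lborel \<Otimes>\<^sub>M lborel)"
    using borel_measurable_weighted_kernel by simp
  have "continuous_on {0..1} (\<lambda>\<alpha>. \<bar>\<psi> \<alpha>\<bar> * (rGamma (2 - \<alpha>) * c powr (1 - \<alpha>)))"
    using c by (intro continuous_intros \<psi> continuous_on_compose2[OF continuous_on_rGamma]) auto
  then have "set_integrable lborel {0..1} (\<lambda>\<alpha>. \<bar>\<psi> \<alpha>\<bar> * (rGamma (2 - \<alpha>) * c powr (1 - \<alpha>)))"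
    by (rule borel_integrable_atLeastAtMost')
  then have *: "set_integrable lborel {0<..<1} (\<lambda>\<alpha>. \<bar>\<psi> \<alpha>\<bar> * (rGamma (2 - \<alpha>) * c powr (1 - \<alpha>)))"
    by (rule set_integrable_subset) auto
  have "(LBINT r. norm (weighted_kernel \<psi> c \<alpha> r)) = indicator {0<..<1} \<alpha> * (\<bar>\<psi> \<alpha>\<bar> * (rGamma (2 - \<alpha>) * c powr (1 - \<alpha>)))" for \<alpha>
  proof (cases "\<alpha> \<in> {0<..<1}")
    case True
    then have "norm (weighted_kernel \<psi> c \<alpha> r) = \<bar>\<psi> \<alpha>\<bar> * frac_kernel c \<alpha> r" for r
      by (simp add: weighted_kernel_def abs_mult frac_kernel_nonneg)
    then show ?thesis using True c by (simp add: integral_frac_kernel)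
  qed (simp add: weighted_kernel_def)
  with * show "integrable lborel (\<lambda>\<alpha>. LBINT r. norm (case (\<alpha>, r) of (\<alpha>, r) \<Rightarrow> weighted_kernel \<psi> c \<alpha> r))"
    by (simp add: set_integrable_def)
  have "integrable lborel (weighted_kernel \<psi> c \<alpha>)" for \<alpha>
    using c by (cases "\<alpha> < 1") (auto simp: weighted_kernel_def[abs_def] integrable_frac_kernel less_imp_le)
  then show "AE \<alpha> in lborel. integrable lborel (\<lambda>r. case (\<alpha>, r) of (\<alpha>, r) \<Rightarrow> weighted_kernel \<psi> c \<alpha> r)"
    by simp
qed

lemma integrable_distributed_kernel: "integrable lborel (distributed_kernel \<psi> c)"
  using lborel_pair.integrable_snd[OF integrable_weighted_kernel]
  by (simp add: distributed_kernel_def[abs_def])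

text \<open>
  The average over the orders and the convolution commute by Fubini, so a distributed-order operator is
  a convolution with the single kernel \<open>distributed_kernel\<close>.
\<close>

lemma integral_distributed_kernel:
  fixes \<phi> :: "real \<Rightarrow> real"
  assumes [measurable]: "\<phi> \<in> borel_measurable borel" and B: "\<And>r. \<bar>\<phi> r\<bar> \<le> B"
  shows "integrable lborel (\<lambda>\<alpha>. indicator {0<..<1} \<alpha> * (\<psi> \<alpha> * (LBINT r. frac_kernel c \<alpha> r * \<phi> r)))"
    and "(LBINT \<alpha>. indicator {0<..<1} \<alpha> * (\<psi> \<alpha> * (LBINT r. frac_kernel c \<alpha> r * \<phi> r))) =
         (LBINT r. distributed_kernel \<psi> c r * \<phi> r)"
proof -
  have m: "(\<lambda>(\<alpha>, r). weighted_kernel \<psi> c \<alpha> r * \<phi> r) \<in> borel_measurable (lborel \<Otimes>\<^sub>M lborel)"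
    using borel_measurable_weighted_kernel by (simp add: case_prod_beta) measurable
  have i: "integrable (lborel \<Otimes>\<^sub>M lborel) (\<lambda>(\<alpha>, r). weighted_kernel \<psi> c \<alpha> r * \<phi> r)"
    by (rule Bochner_Integration.integrable_bound[OF integrable_mult_left[of B, OF integrable_weighted_kernel] m])
       (use order_trans[OF B abs_ge_self] in \<open>auto simp: abs_mult case_prod_beta intro!: mult_left_mono AE_I2\<close>)
  have e: "(LBINT r. weighted_kernel \<psi> c \<alpha> r * \<phi> r) = indicator {0<..<1} \<alpha> * (\<psi> \<alpha> * (LBINT r. frac_kernel c \<alpha> r * \<phi> r))" for \<alpha>
    unfolding weighted_kernel_def by (simp add: mult.assoc flip: integral_mult_right_zero)
  show "integrable lborel (\<lambda>\<alpha>. indicator {0<..<1} \<alpha> * (\<psi> \<alpha> * (LBINT r. frac_kernel c \<alpha> r * \<phi> r)))"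
    using lborel_pair.integrable_fst[OF i] by (simp add: e)
  show "(LBINT \<alpha>. indicator {0<..<1} \<alpha> * (\<psi> \<alpha> * (LBINT r. frac_kernel c \<alpha> r * \<phi> r))) =
         (LBINT r. distributed_kernel \<psi> c r * \<phi> r)"
    using lborel_pair.Fubini_integral[OF i]
    by (simp add: e distributed_kernel_def)
qed

lemma integrable_weighted_kernel_order: "integrable lborel (\<lambda>\<alpha>. weighted_kernel \<psi> c \<alpha> r)"
proof (cases "r \<in> {0<..<c}")
  case True
  have "continuous_on {0..1} (\<lambda>\<alpha>. \<psi> \<alpha> * (rGamma (1 - \<alpha>) * r powr (- \<alpha>)))"
    using True by (intro continuous_intros \<psi> continuous_on_compose2[OF continuous_on_rGamma]) auto
  then have "set_integrable lborel {0..1} (\<lambda>\<alpha>. \<psi> \<alpha> * (rGamma (1 - \<alpha>) * r powr (- \<alpha>)))"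
    by (rule borel_integrable_atLeastAtMost')
  then have "set_integrable lborel {0<..<1} (\<lambda>\<alpha>. \<psi> \<alpha> * (rGamma (1 - \<alpha>) * r powr (- \<alpha>)))"
    by (rule set_integrable_subset) auto
  then show ?thesis using True by (simp add: set_integrable_def weighted_kernel_def frac_kernel_def mult.assoc)
qed (simp add: weighted_kernel_def frac_kernel_def)

end

section \<open>The distributed-order derivatives as convolutions\<close>

context piecewise_C1
begin

lemma deriv:
  assumes "t \<in> {a<..<b} - S"
  shows "(x has_real_derivative g t) (at t)"
  using clamped_deriv[of t]
  by (rule has_field_derivative_transform_within_open[of _ _ _ "{a<..<b}"]) (use assms in auto)

lemma clamped_continuous: "continuous_on UNIV (\<lambda>t. x (clamp_real a b t))"
proof (rule lipschitz_on_continuous_on[of B])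
  have "0 \<le> B" using g_bound[of a] by linarith
  then show "B-lipschitz_on UNIV (\<lambda>t. x (clamp_real a b t))"
    using clamped_lipschitz by (auto simp: lipschitz_on_def dist_real_def)
qed

lemma continuous: "continuous_on {a..b} x"
  using continuous_on_subset[OF clamped_continuous subset_UNIV] by (rule continuous_on_eq) auto

lemma clamped_measurable [measurable]: "(\<lambda>t. x (clamp_real a b t)) \<in> borel_measurable borel"
  by (rule borel_measurable_continuous_onI[OF clamped_continuous])

lemma clamped_bounded:
  obtains M where "\<And>t. \<bar>x (clamp_real a b t)\<bar> \<le> M"
proof -
  have "bounded (x ` {a..b})" using continuous by (intro compact_imp_bounded compact_continuous_image) auto
  then obtain M where "\<forall>t\<in>{a..b}. \<bar>x t\<bar> \<le> M" by (auto simp: bounded_iff)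
  then show ?thesis using ab by (intro that[of M]) (auto simp: clamp_real_def)
qed

lemma kernel_integral_deriv:
  assumes "integrable lborel k" "\<sigma> \<noteq> 0"
  shows "((\<lambda>t. LBINT r. k r * (x (clamp_real a b (t + \<sigma> * r)) - d)) has_real_derivative
           (LBINT r. k r * g (t + \<sigma> * r))) (at t)"
proof -
  obtain M where M: "\<And>t. \<bar>x (clamp_real a b t)\<bar> \<le> M" using clamped_bounded by blast
  have M': "\<bar>x (clamp_real a b t) - d\<bar> \<le> M + \<bar>d\<bar>" for t using M[of t] by linarith
  show ?thesis
    by (rule has_derivative_integral_kernel[OF assms M', where B=B and g=g and S=S])
       (use clamped_lipschitz S clamped_deriv in \<open>auto intro!: derivative_eq_intros\<close>)
qed

lemma kernel_integrable:
  assumes "integrable lborel k"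
  shows "integrable lborel (\<lambda>r. k r * (x (clamp_real a b (t + \<sigma> * r)) - d))"
proof -
  obtain M where M: "\<And>t. \<bar>x (clamp_real a b t)\<bar> \<le> M" using clamped_bounded by blast
  have "\<bar>x (clamp_real a b t) - d\<bar> \<le> \<bar>M + \<bar>d\<bar>\<bar>" for t using M[of t] by linarith
  moreover have [measurable]: "k \<in> borel_measurable borel" using assms by auto
  ultimately show ?thesis
    by (intro Bochner_Integration.integrable_bound[OF integrable_mult_left[of "M + \<bar>d\<bar>", OF assms]])
       (auto simp: abs_mult intro!: mult_left_mono)
qed

text \<open>
  The cut-off of the kernel is invisible: \<open>x - x(a)\<close> clamped vanishes to the left of \<open>a\<close>.
\<close>

lemma RL_integral_left_eq:
  assumes "t \<in> {a..b}"
  shows "RL_integral_left a (1 - \<alpha>) (\<lambda>s. x s - x a) t =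
           (LBINT r. frac_kernel (b - a) \<alpha> r * (x (clamp_real a b (t + (- 1) * r)) - x a))"
proof -
  have "RL_integral_left a (1 - \<alpha>) (\<lambda>s. x s - x a) t =
      rGamma (1 - \<alpha>) * (LBINT s. indicator {a<..<t} s * ((t - s) powr (- \<alpha>) * (x s - x a)))"
    using assms by (simp add: RL_integral_left_def interval_lebesgue_integral_def
        set_lebesgue_integral_def rGamma_inverse_Gamma divide_inverse)
  also have "\<dots> = rGamma (1 - \<alpha>) * (LBINT r. indicator {a<..<t} (t + (-1) * r) * ((t - (t + (-1) * r)) powr (- \<alpha>) * (x (t + (-1) * r) - x a)))"
    by (subst lborel_integral_real_affine[of "-1" _ t]) auto
  also have "\<dots> = (LBINT r. rGamma (1 - \<alpha>) * (indicator {a<..<t} (t + (-1) * r) * ((t - (t + (-1) * r)) powr (- \<alpha>) * (x (t + (-1) * r) - x a))))"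
    by (rule integral_mult_right_zero[symmetric])
  also have "\<dots> = (LBINT r. frac_kernel (b - a) \<alpha> r * (x (clamp_real a b (t + (- 1) * r)) - x a))"
    using assms ab
    by (intro Bochner_Integration.integral_cong) (auto simp: frac_kernel_def indicator_def)
  finally show ?thesis .
qed

text \<open>
  \<open>x\<close> need not vanish at \<open>b\<close>, so the constant \<open>x(b)\<close> is split off and integrated explicitly; the rest,
  clamped, vanishes to the right of \<open>b\<close>.
\<close>

lemma RL_integral_right_eq:
  assumes "t \<in> {a..b}" "\<alpha> < 1"
  shows "RL_integral_right b (1 - \<alpha>) x t =
           (LBINT r. frac_kernel (b - a) \<alpha> r * (x (clamp_real a b (t + 1 * r)) - x b))
           + x b * (rGamma (2 - \<alpha>) * (b - t) powr (1 - \<alpha>))"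
proof -
  have "RL_integral_right b (1 - \<alpha>) x t =
      rGamma (1 - \<alpha>) * (LBINT s. indicator {t<..<b} s * ((s - t) powr (- \<alpha>) * x s))"
    using assms by (simp add: RL_integral_right_def interval_lebesgue_integral_def
        set_lebesgue_integral_def rGamma_inverse_Gamma divide_inverse)
  also have "\<dots> = rGamma (1 - \<alpha>) * (LBINT r. indicator {t<..<b} (t + 1 * r) * ((t + 1 * r - t) powr (- \<alpha>) * x (t + 1 * r)))"
    by (subst lborel_integral_real_affine[of 1 _ t]) auto
  also have "\<dots> = (LBINT r. rGamma (1 - \<alpha>) * (indicator {t<..<b} (t + 1 * r) * ((t + 1 * r - t) powr (- \<alpha>) * x (t + 1 * r))))"
    by (rule integral_mult_right_zero[symmetric])
  also have "\<dots> = (LBINT r. frac_kernel (b - a) \<alpha> r * (x (clamp_real a b (t + 1 * r)) - x b) + x b * frac_kernel (b - t) \<alpha> r)"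
    using assms ab
    by (intro Bochner_Integration.integral_cong) (auto simp: frac_kernel_def indicator_def algebra_simps)
  also have "\<dots> = (LBINT r. frac_kernel (b - a) \<alpha> r * (x (clamp_real a b (t + 1 * r)) - x b)) + x b * (LBINT r. frac_kernel (b - t) \<alpha> r)"
    using assms ab
    by (subst Bochner_Integration.integral_add[OF kernel_integrable[OF integrable_frac_kernel]
          integrable_mult_right[OF integrable_frac_kernel]]) auto
  finally show ?thesis using assms by (simp add: integral_frac_kernel)
qed

lemma Caputo_deriv_left_eq:
  assumes "t \<in> {a<..<b}" "\<alpha> < 1"
  shows "Caputo_deriv_left a b \<alpha> x t = (LBINT r. frac_kernel (b - a) \<alpha> r * g (t + (- 1) * r))"
proof -
  have "((\<lambda>t. LBINT r. frac_kernel (b - a) \<alpha> r * (x (clamp_real a b (t + (- 1) * r)) - x a)) has_real_derivative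
          (LBINT r. frac_kernel (b - a) \<alpha> r * g (t + (- 1) * r))) (at t)"
    using assms ab by (intro kernel_integral_deriv integrable_frac_kernel) auto
  then have "(RL_integral_left a (1 - \<alpha>) (\<lambda>s. x s - x a) has_real_derivative
          (LBINT r. frac_kernel (b - a) \<alpha> r * g (t + (- 1) * r))) (at t)"
    by (rule has_field_derivative_transform_within_open[of _ _ _ "{a<..<b}"])
       (use assms in \<open>simp_all add: RL_integral_left_eq\<close>)
  then show ?thesis using assms
    by (simp add: Caputo_deriv_left_def at_within_Icc_at vector_derivative_at
        has_real_derivative_iff_has_vector_derivative)
qed

text \<open>
  Differentiating the power that comes from \<open>x(b)\<close> produces the singular term, which blows up at
  \<open>t = b\<close> but is integrable there.
\<close>

lemma RL_deriv_right_eq: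
  assumes t: "t \<in> {a<..<b}" and \<alpha>: "\<alpha> < 1"
  shows "RL_deriv_right a b \<alpha> x t =
           x b * frac_kernel (b - a) \<alpha> (b - t) - (LBINT r. frac_kernel (b - a) \<alpha> r * g (t + 1 * r))"
proof -
  have 1: "((\<lambda>t. LBINT r. frac_kernel (b - a) \<alpha> r * (x (clamp_real a b (t + 1 * r)) - x b)) has_real_derivative
          (LBINT r. frac_kernel (b - a) \<alpha> r * g (t + 1 * r))) (at t)"
    using assms ab by (intro kernel_integral_deriv integrable_frac_kernel) auto
  have r: "rGamma (1 - \<alpha>) = (1 - \<alpha>) * rGamma (2 - \<alpha>)"
    using rGamma_plus1[of "1 - \<alpha>"] by (simp add: algebra_simps)
  have "((\<lambda>t. x b * (rGamma (2 - \<alpha>) * (b - t) powr (1 - \<alpha>))) has_real_derivative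
          x b * (rGamma (2 - \<alpha>) * ((1 - \<alpha>) * (b - t) powr (1 - \<alpha> - 1) * (- 1)))) (at t)"
    using t by (auto intro!: derivative_eq_intros)
  also have "x b * (rGamma (2 - \<alpha>) * ((1 - \<alpha>) * (b - t) powr (1 - \<alpha> - 1) * (- 1))) =
      - (x b * frac_kernel (b - a) \<alpha> (b - t))"
    using t by (simp add: frac_kernel_def r)
  finally have 2: "((\<lambda>t. x b * (rGamma (2 - \<alpha>) * (b - t) powr (1 - \<alpha>))) has_real_derivative
      - (x b * frac_kernel (b - a) \<alpha> (b - t))) (at t)" .
  have "(RL_integral_right b (1 - \<alpha>) x has_real_derivative
      ((LBINT r. frac_kernel (b - a) \<alpha> r * g (t + 1 * r)) + - (x b * frac_kernel (b - a) \<alpha> (b - t)))) (at t)"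
    by (rule has_field_derivative_transform_within_open[OF DERIV_add[OF 1 2], of "{a<..<b}"])
       (use assms in \<open>simp_all add: RL_integral_right_eq\<close>)
  then show ?thesis using assms
    by (simp add: RL_deriv_right_def at_within_Icc_at vector_derivative_at
        has_real_derivative_iff_has_vector_derivative)
qed

lemma distributed_Caputo_left_eq:
  assumes \<psi>: "continuous_on {0..1} \<psi>" and t: "t \<in> {a<..<b}"
  shows "distributed_Caputo_left a b \<psi> x t = (LBINT r. distributed_kernel \<psi> (b - a) r * g (t + (- 1) * r))"
proof -
  have "distributed_Caputo_left a b \<psi> x t =
      (LBINT \<alpha>. indicator {0<..<1} \<alpha> * (\<psi> \<alpha> * Caputo_deriv_left a b \<alpha> x t))"
    by (simp add: distributed_Caputo_left_def interval_lebesgue_integral_def set_lebesgue_integral_def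
        zero_ereal_def one_ereal_def)
  also have "\<dots> = (LBINT \<alpha>. indicator {0<..<1} \<alpha> * (\<psi> \<alpha> * (LBINT r. frac_kernel (b - a) \<alpha> r * g (t + (- 1) * r))))"
    by (intro Bochner_Integration.integral_cong) (auto simp: indicator_def Caputo_deriv_left_eq[OF t])
  also have "\<dots> = (LBINT r. distributed_kernel \<psi> (b - a) r * g (t + (- 1) * r))"
    using ab g_bound by (intro integral_distributed_kernel(2)[OF \<psi>]) auto
  finally show ?thesis .
qed

lemma distributed_RL_right_eq:
  assumes \<psi>: "continuous_on {0..1} \<psi>" and t: "t \<in> {a<..<b}"
  shows "distributed_RL_right a b \<psi> x t =
           x b * distributed_kernel \<psi> (b - a) (b - t)
           - (LBINT r. distributed_kernel \<psi> (b - a) r * g (t + 1 * r))"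
proof -
  have "distributed_RL_right a b \<psi> x t =
      (LBINT \<alpha>. indicator {0<..<1} \<alpha> * (\<psi> \<alpha> * RL_deriv_right a b \<alpha> x t))"
    by (simp add: distributed_RL_right_def interval_lebesgue_integral_def set_lebesgue_integral_def
        zero_ereal_def one_ereal_def)
  also have "\<dots> = (LBINT \<alpha>. x b * weighted_kernel \<psi> (b - a) \<alpha> (b - t) -
      indicator {0<..<1} \<alpha> * (\<psi> \<alpha> * (LBINT r. frac_kernel (b - a) \<alpha> r * g (t + 1 * r))))"
    by (intro Bochner_Integration.integral_cong)
       (auto simp: indicator_def RL_deriv_right_eq[OF t] weighted_kernel_def algebra_simps)
  also have "\<dots> = (LBINT \<alpha>. x b * weighted_kernel \<psi> (b - a) \<alpha> (b - t)) -
      (LBINT \<alpha>. indicator {0<..<1} \<alpha> * (\<psi> \<alpha> * (LBINT r. frac_kernel (b - a) \<alpha> r * g (t + 1 * r))))"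
    using ab g_bound
    by (intro Bochner_Integration.integral_diff integrable_mult_right
         integrable_weighted_kernel_order[OF \<psi>] integral_distributed_kernel(1)[OF \<psi>]) auto
  also have "(LBINT \<alpha>. indicator {0<..<1} \<alpha> * (\<psi> \<alpha> * (LBINT r. frac_kernel (b - a) \<alpha> r * g (t + 1 * r))))
      = (LBINT r. distributed_kernel \<psi> (b - a) r * g (t + 1 * r))"
    using ab g_bound by (intro integral_distributed_kernel(2)[OF \<psi>]) auto
  finally show ?thesis by (simp add: distributed_kernel_def)
qed

end

section \<open>Integration by parts for distributed-order derivatives\<close>

lemma distributed_kernel_outside: "r \<notin> {0<..<c} \<Longrightarrow> distributed_kernel \<psi> c r = 0"
  by (simp add: distributed_kernel_def weighted_kernel_def frac_kernel_def)

text \<open>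
  The majorant behind both applications of Fubini below.
\<close>

lemma integrable_window_kernel:
  fixes k :: "real \<Rightarrow> real" and \<phi> :: "real \<times> real \<Rightarrow> real"
  assumes k: "integrable lborel k" and \<phi>: "\<phi> \<in> borel_measurable (borel \<Otimes>\<^sub>M borel)"
    and M: "\<And>p. \<bar>\<phi> p\<bar> \<le> M"
  shows "integrable (lborel \<Otimes>\<^sub>M lborel) (\<lambda>(t, r). indicator {a<..<b} t * (k r * \<phi> (t, r)))"
proof -
  have [measurable]: "k \<in> borel_measurable borel" using k by auto
  note \<phi>[measurable]
  have i: "integrable lborel (indicator {a<..<b} :: real \<Rightarrow> real)"
    by (cases "a \<le> b") (simp_all add: integrable_indicator_iff)
  have "integrable (lborel \<Otimes>\<^sub>M lborel) (\<lambda>(t, r). indicator {a<..<b} t * k r)"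
  proof (rule lborel_pair.Fubini_integrable)
    show "integrable lborel (\<lambda>t. LBINT r. norm (case (t, r) of (t, r) \<Rightarrow> indicator {a<..<b} t * k r))"
      using i by (simp add: abs_mult)
  qed (use k in auto)
  from integrable_mult_left[of M, OF this] show ?thesis
    by (rule Bochner_Integration.integrable_bound)
       (use order_trans[OF M abs_ge_self] in \<open>auto simp: abs_mult mult.assoc case_prod_beta intro!: mult_left_mono AE_I2\<close>)
qed

lemma integrable_window_bounded:
  fixes f :: "real \<Rightarrow> real"
  assumes "f \<in> borel_measurable borel" and M: "\<And>t. \<bar>f t\<bar> \<le> M"
  shows "integrable lborel (\<lambda>t. indicator {a<..<b} t * f t)"
proof -
  have "integrable lborel (indicator {a<..<b} :: real \<Rightarrow> real)"
    by (cases "a \<le> b") (simp_all add: integrable_indicator_iff)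
  from integrable_mult_left[of M, OF this] show ?thesis
    by (rule Bochner_Integration.integrable_bound)
       (use order_trans[OF M abs_ge_self] assms(1) in \<open>auto simp: abs_mult intro!: mult_left_mono AE_I2\<close>)
qed

lemma kernel_integral_bounded:
  fixes k :: "real \<Rightarrow> real"
  assumes k: "integrable lborel k" and M: "\<And>r. \<bar>\<phi> r\<bar> \<le> M"
  shows "\<bar>LBINT r. k r * \<phi> r\<bar> \<le> (LBINT r. \<bar>k r\<bar>) * M"
proof (cases "integrable lborel (\<lambda>r. k r * \<phi> r)")
  case True
  have "\<bar>LBINT r. k r * \<phi> r\<bar> \<le> (LBINT r. \<bar>k r * \<phi> r\<bar>)" by (rule integral_abs_bound)
  also have "\<dots> \<le> (LBINT r. \<bar>k r\<bar> * M)"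
    using integrable_abs[OF True] k M by (intro integral_mono) (auto simp: abs_mult intro!: mult_left_mono)
  finally show ?thesis by simp
next
  case False
  moreover have "0 \<le> M" using M[of 0] by linarith
  ultimately show ?thesis by (simp add: not_integrable_integral_eq)
qed

text \<open>
  Convolution with \<open>k(r)\<close> and with \<open>k(-r)\<close> are adjoint: substitute \<open>s = t + r\<close> in the double integral.
  The support conditions ensure that the window \<open>a < t < b\<close> may be exchanged for \<open>a < s < b\<close>: since
  \<open>r > 0\<close>, \<open>s < b\<close> forces \<open>t < b\<close>, and for \<open>t \<le> a\<close> the integrand vanishes.
\<close>

lemma convolution_transpose:
  fixes k h l :: "real \<Rightarrow> real"
  assumes k: "integrable lborel k" "\<And>r. r \<le> 0 \<Longrightarrow> k r = 0"
    and h: "h \<in> borel_measurable borel" "\<And>t. \<bar>h t\<bar> \<le> M" "\<And>t. t \<le> a \<Longrightarrow> h t = 0"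
    and l: "l \<in> borel_measurable borel" "\<And>t. \<bar>l t\<bar> \<le> N" "\<And>t. t \<notin> {a<..<b} \<Longrightarrow> l t = 0"
  shows "(LBINT t. indicator {a<..<b} t * (h t * (LBINT r. k r * l (t + 1 * r)))) =
         (LBINT s. indicator {a<..<b} s * (l s * (LBINT r. k r * h (s + (- 1) * r))))"
proof -
  have [measurable]: "k \<in> borel_measurable borel" using k by auto
  note h(1)[measurable] l(1)[measurable]
  have bd: "\<bar>h s * l t\<bar> \<le> M * N" for s t
    using mult_mono[OF h(2)[of s] l(2)[of t]] h(2)[of s] by (simp add: abs_mult)
  define F where "F t r = indicator {a<..<b} t * (k r * (h t * l (t + r)))" for t r
  define G where "G t r = indicator {a<..<b} t * (k r * (h (t - r) * l t))" for t r
  have F: "integrable (lborel \<Otimes>\<^sub>M lborel) (\<lambda>(t, r). F t r)"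
    using integrable_window_kernel[OF k(1), of "\<lambda>(t, r). h t * l (t + r)" "M * N" a b] bd
    by (simp add: F_def case_prod_beta)
  have G: "integrable (lborel \<Otimes>\<^sub>M lborel) (\<lambda>(t, r). G t r)"
    using integrable_window_kernel[OF k(1), of "\<lambda>(t, r). h (t - r) * l t" "M * N" a b] bd
    by (simp add: G_def case_prod_beta)
  have shear: "(LBINT t. F t r) = (LBINT s. G s r)" for r
  proof -
    have "(LBINT t. F t r) = (LBINT s. F (- r + 1 * s) r)"
      by (subst lborel_integral_real_affine[of 1 _ "- r"]) auto
    also have "\<dots> = (LBINT s. G s r)"
    proof (rule Bochner_Integration.integral_cong)
      fix s
      show "F (- r + 1 * s) r = G s r"
        using k(2)[of r] l(3)[of s] h(3)[of "s - r"]
        by (cases "r \<le> 0"; cases "s \<in> {a<..<b}"; cases "s - r \<le> a") (auto simp: F_def G_def indicator_def)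
    qed simp
    finally show ?thesis .
  qed
  have "(LBINT t. indicator {a<..<b} t * (h t * (LBINT r. k r * l (t + 1 * r)))) = (LBINT t. LBINT r. F t r)"
    by (intro Bochner_Integration.integral_cong)
       (auto simp: F_def mult.left_commute simp flip: integral_mult_right_zero)
  also have "\<dots> = (LBINT r. LBINT t. F t r)" by (rule lborel_pair.Fubini_integral[OF F, symmetric])
  also have "\<dots> = (LBINT r. LBINT t. G t r)" by (simp only: shear)
  also have "\<dots> = (LBINT t. LBINT r. G t r)" by (rule lborel_pair.Fubini_integral[OF G])
  also have "\<dots> = (LBINT s. indicator {a<..<b} s * (l s * (LBINT r. k r * h (s + (- 1) * r))))"
    by (intro Bochner_Integration.integral_cong)
       (auto simp: G_def mult.left_commute mult.commute[of _ "l _"] simp flip: integral_mult_right_zero)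
  finally show ?thesis .
qed

text \<open>
  With \<open>h = x - x(a)\<close>, \<open>H = K * h\<close> and \<open>H' = K * h'\<close>, ordinary integration by parts gives
  \<open>\<integral> \<lambda> H' = \<lambda>(b) H(b) - \<integral> \<lambda>' H\<close>, because \<open>H(a) = 0\<close>. The right derivative of \<open>\<lambda>\<close> consists of the same
  two pieces: paired with \<open>h\<close>, its singular term \<open>\<lambda>(b) K(b - t)\<close> integrates to \<open>\<lambda>(b) H(b)\<close> and its regular
  term to \<open>- \<integral> \<lambda>' H\<close> by transposing the convolution. No boundary term remains: \<open>\<lambda>\<close> is bounded, so
  the right fractional integrals of \<open>\<lambda>\<close> vanish at \<open>b\<close>.
\<close>

lemma distributed_integration_by_parts:
  assumes ab: "a < b" and \<psi>: "continuous_on {0..1} \<psi>"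
    and x: "x \<in> PC1 a b" and lam: "lam \<in> PC1 a b"
  shows "set_integrable lborel {a<..<b} (\<lambda>t. lam t * distributed_Caputo_left a b \<psi> x t)" (is ?A)
    and "set_integrable lborel {a<..<b} (\<lambda>t. (x t - x a) * distributed_RL_right a b \<psi> lam t)" (is ?B)
    and "(LBINT t:{a<..<b}. lam t * distributed_Caputo_left a b \<psi> x t) =
         (LBINT t:{a<..<b}. (x t - x a) * distributed_RL_right a b \<psi> lam t)" (is ?C)
proof -
  obtain g S B where "piecewise_C1 a b x g S B" using PC1_imp_piecewise_C1[OF ab x] .
  then interpret X: piecewise_C1 a b x g S B .
  obtain l T D where "piecewise_C1 a b lam l T D" using PC1_imp_piecewise_C1[OF ab lam] .
  then interpret Y: piecewise_C1 a b lam l T D .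
  define k where "k = distributed_kernel \<psi> (b - a)"
  have k: "integrable lborel k" using integrable_distributed_kernel[OF \<psi>] ab by (simp add: k_def)
  have [measurable]: "k \<in> borel_measurable borel" using k by auto
  have k_out: "k r = 0" if "r \<notin> {0<..<b - a}" for r using that by (simp add: k_def distributed_kernel_outside)
  define h where "h t = x (clamp_real a b t) - x a" for t
  define m where "m t = lam (clamp_real a b t)" for t
  have [measurable]: "h \<in> borel_measurable borel" "m \<in> borel_measurable borel"
    unfolding h_def m_def by measurable
  obtain M where M: "\<And>t. \<bar>h t\<bar> \<le> M"
  proof -
    obtain M where M: "\<And>t. \<bar>x (clamp_real a b t)\<bar> \<le> M" using X.clamped_bounded by blast
    have "\<bar>h t\<bar> \<le> M + \<bar>x a\<bar>" for t using M[of t] by (simp add: h_def)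
    then show ?thesis using that by blast
  qed
  obtain N where N: "\<And>t. \<bar>m t\<bar> \<le> N" using Y.clamped_bounded unfolding m_def by blast
  define H where "H t = (LBINT r. k r * h (t + (- 1) * r))" for t
  define C where "C t = (LBINT r. k r * g (t + (- 1) * r))" for t
  define E where "E t = (LBINT r. k r * l (t + 1 * r))" for t
  have HC: "(H has_real_derivative C t) (at t)" for t
    unfolding H_def[abs_def] C_def h_def using X.kernel_integral_deriv[OF k, of "-1"] by simp
  have H_cont: "continuous_on UNIV H" using HC by (auto intro!: continuous_at_imp_continuous_on DERIV_isCont)
  have [measurable]: "H \<in> borel_measurable borel" "C \<in> borel_measurable borel" "E \<in> borel_measurable borel"
    unfolding H_def[abs_def] C_def[abs_def] E_def[abs_def] by measurable
  have h_left: "h t = 0" if "t \<le> a" for t using that ab by (simp add: h_def)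
  have "k r * h (a + (- 1) * r) = 0" for r
    by (cases "r \<le> 0") (auto simp: k_out h_left)
  then have H_a: "H a = 0" by (simp only: H_def Bochner_Integration.integral_zero)
  define K where "K = (LBINT r. \<bar>k r\<bar>)"
  have K0: "0 \<le> K" unfolding K_def by simp
  have Cb: "\<bar>C t\<bar> \<le> K * B" and Hb: "\<bar>H t\<bar> \<le> K * M" and Eb: "\<bar>E t\<bar> \<le> K * D" for t
    unfolding C_def H_def E_def K_def
    by (intro kernel_integral_bounded k X.g_bound M Y.g_bound)+
  have prod_bd: "\<bar>u * v\<bar> \<le> U * V" if "\<bar>u\<bar> \<le> U" "\<bar>v\<bar> \<le> V" for u v U V :: real
    unfolding abs_mult using that by (intro mult_mono) auto
  have i1: "integrable lborel (\<lambda>t. indicator {a<..<b} t * (m t * C t))"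
    by (rule integrable_window_bounded[of _ "N * (K * B)"]) (use prod_bd N Cb in auto)
  have i2: "integrable lborel (\<lambda>t. indicator {a<..<b} t * (l t * H t))"
    by (rule integrable_window_bounded[of _ "D * (K * M)"]) (use prod_bd Y.g_bound Hb in auto)
  have i3: "integrable lborel (\<lambda>t. indicator {a<..<b} t * (h t * E t))"
    by (rule integrable_window_bounded[of _ "M * (K * D)"]) (use prod_bd M Eb in auto)
  \<comment> \<open>The product \<open>lam * H\<close> is continuous and differentiable off the finitely many kinks of \<open>lam\<close>.\<close>
  have "((\<lambda>t. l t * H t + m t * C t) has_integral (lam b * H b - lam a * H a)) {a..b}"
  proof (rule fundamental_theorem_of_calculus_interior_strong[of "T \<union> {a, b}"])
    show "continuous_on {a..b} (\<lambda>t. lam t * H t)"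
      by (intro continuous_intros Y.continuous continuous_on_subset[OF H_cont]) auto
    fix t assume "t \<in> {a<..<b} - (T \<union> {a, b})"
    then have "(lam has_real_derivative l t) (at t)" "m t = lam t" using Y.deriv by (auto simp: m_def)
    with HC[of t] show "((\<lambda>t. lam t * H t) has_vector_derivative l t * H t + m t * C t) (at t)"
      unfolding has_real_derivative_iff_has_vector_derivative[symmetric]
      by (auto intro!: derivative_eq_intros)
  qed (use Y.S ab in auto)
  then have hi: "((\<lambda>t. l t * H t + m t * C t) has_integral (lam b * H b)) {a<..<b}"
    using has_integral_Icc_iff_Ioo H_a by fastforce
  have "set_integrable lborel {a<..<b} (\<lambda>t. l t * H t + m t * C t)"
    unfolding set_integrable_def using Bochner_Integration.integrable_add[OF i2 i1] by (simp add: distrib_left)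
  from set_borel_integral_eq_integral(2)[OF this]
  have "(LBINT t:{a<..<b}. l t * H t + m t * C t) = lam b * H b"
    using integral_unique[OF hi] by simp
  then have parts: "(LBINT t. indicator {a<..<b} t * (m t * C t)) = lam b * H b - (LBINT t. indicator {a<..<b} t * (l t * H t))"
    using Bochner_Integration.integral_add[OF i2 i1] by (simp add: set_lebesgue_integral_def distrib_left)
  \<comment> \<open>The singular term is paired with \<open>h\<close> by substituting \<open>t = b - r\<close>; the support of the kernel
      enforces the window \<open>a < t < b\<close>.\<close>
  have e: "indicator {a<..<b} (b + (-1) * r) * (h (b + (-1) * r) * k (b - (b + (-1) * r))) = k r * h (b + (- 1) * r)" for r
    using k_out[of r] by (cases "r \<in> {0<..<b - a}") (auto simp: indicator_def)
  have "integrable lborel (\<lambda>r. k r * h (b + (- 1) * r))"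
    unfolding h_def by (rule X.kernel_integrable[OF k])
  then have i4: "integrable lborel (\<lambda>t. indicator {a<..<b} t * (h t * k (b - t)))"
    using lborel_integrable_real_affine_iff[of "-1" "\<lambda>t. indicator {a<..<b} t * (h t * k (b - t))" b] by (simp only: e)
  have e4: "(LBINT t. indicator {a<..<b} t * (h t * k (b - t))) = H b"
    using lborel_integral_real_affine[of "-1" "\<lambda>t. indicator {a<..<b} t * (h t * k (b - t))" b]
    unfolding e H_def by simp
  have e3: "(LBINT t. indicator {a<..<b} t * (h t * E t)) = (LBINT t. indicator {a<..<b} t * (l t * H t))"
    unfolding E_def H_def
    by (rule convolution_transpose[OF k _ _ M _ _ Y.g_bound])
       (use h_left Y.g_outside k_out in auto)
  have A: "indicator {a<..<b} t *\<^sub>R (lam t * distributed_Caputo_left a b \<psi> x t) = indicator {a<..<b} t * (m t * C t)" for t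
    using X.distributed_Caputo_left_eq[OF \<psi>] by (simp add: indicator_def m_def C_def k_def)
  have B: "indicator {a<..<b} t *\<^sub>R ((x t - x a) * distributed_RL_right a b \<psi> lam t) =
      lam b * (indicator {a<..<b} t * (h t * k (b - t))) - indicator {a<..<b} t * (h t * E t)" for t
  proof (cases "t \<in> {a<..<b}")
    case True
    then have "distributed_RL_right a b \<psi> lam t = lam b * k (b - t) - E t"
      using Y.distributed_RL_right_eq[OF \<psi>] by (simp add: E_def k_def)
    with True show ?thesis by (simp add: h_def right_diff_distrib mult.left_commute)
  qed simp
  show ?A unfolding set_integrable_def A by (rule i1)
  show ?B unfolding set_integrable_def B by (intro Bochner_Integration.integrable_diff integrable_mult_right i3 i4)
  show ?C unfolding set_lebesgue_integral_def A B
    by (subst Bochner_Integration.integral_diff[OF integrable_mult_right[OF i4] i3])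
       (simp add: parts e3 e4)
qed

section \<open>Concavity and the running payoff\<close>

text \<open>
  Restricted to the segment from \<open>(p, q)\<close> to \<open>(x, u)\<close> this is the tangent inequality for concave functions
  of one variable. Total differentiability at \<open>(p, q)\<close> expresses the slope of that restriction through the
  two partial derivatives.
\<close>

lemma concave_on_gradient_inequality:
  fixes F :: "real \<Rightarrow> real \<Rightarrow> real"
  assumes conc: "concave_on UNIV (\<lambda>(x, u). F x u)"
    and D: "((\<lambda>(x, u). F x u) has_derivative D) (at (p, q))"
  shows "F x u - F p q \<le> deriv (\<lambda>y. F y q) p * (x - p) + deriv (\<lambda>v. F p v) q * (u - q)"
proof -
  interpret D: bounded_linear D using D by (rule has_derivative_bounded_linear)
  have line: "((\<lambda>s. F (p + s * v) (q + s * w)) has_real_derivative D (v, w)) (at 0)" for v w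
  proof -
    have "((\<lambda>s. (p + s * v, q + s * w)) has_derivative (\<lambda>s. (s * v, s * w))) (at 0)"
      by (auto intro!: derivative_eq_intros)
    from has_derivative_compose[OF this, of "\<lambda>(x, u). F x u" D] D
    have "((\<lambda>s. F (p + s * v) (q + s * w)) has_derivative (\<lambda>s. D (s * v, s * w))) (at 0)"
      by simp
    moreover have "D (s * v, s * w) = D (v, w) * s" for s
      using D.scaleR[of s "(v, w)"] by (simp add: mult.commute)
    ultimately show ?thesis by (simp add: has_field_derivative_def)
  qed
  have dx: "deriv (\<lambda>y. F y q) p = D (1, 0)"
    using line[of 1 0] DERIV_shift[of "\<lambda>y. F y q" _ 0 p] by (simp add: add.commute DERIV_imp_deriv)
  have du: "deriv (\<lambda>v. F p v) q = D (0, 1)"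
    using line[of 0 1] DERIV_shift[of "\<lambda>v. F p v" _ 0 q] by (simp add: add.commute DERIV_imp_deriv)
  have "convex_on UNIV (\<lambda>s. - F (p + s * (x - p)) (q + s * (u - q)))"
  proof (rule convex_onI)
    fix t r s :: real assume t: "0 < t" "t < 1"
    have "(p + ((1 - t) *\<^sub>R r + t *\<^sub>R s) * (x - p), q + ((1 - t) *\<^sub>R r + t *\<^sub>R s) * (u - q)) =
       (1 - t) *\<^sub>R (p + r * (x - p), q + r * (u - q)) + t *\<^sub>R (p + s * (x - p), q + s * (u - q))"
      by (simp add: algebra_simps)
    then show "- F (p + ((1 - t) *\<^sub>R r + t *\<^sub>R s) * (x - p)) (q + ((1 - t) *\<^sub>R r + t *\<^sub>R s) * (u - q)) \<le>
       (1 - t) * (- F (p + r * (x - p)) (q + r * (u - q))) + t * (- F (p + s * (x - p)) (q + s * (u - q)))"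
      using convex_onD[OF conc[unfolded concave_on_def], of t "(p + r * (x - p), q + r * (u - q))" "(p + s * (x - p), q + s * (u - q))"] t
      by simp
  qed simp
  from convex_on_imp_above_tangent[OF this, of 0 1 "- D (x - p, u - q)"]
    DERIV_minus[OF line[of "x - p" "u - q"]]
  have "F x u - F p q \<le> D (x - p, u - q)" by simp
  also have "D (x - p, u - q) = D ((x - p) *\<^sub>R (1, 0) + (u - q) *\<^sub>R (0, 1))" by simp
  also have "\<dots> = D (1, 0) * (x - p) + D (0, 1) * (u - q)"
    by (simp only: D.add D.scaleR) (simp add: mult.commute)
  finally show ?thesis by (simp only: dx du)
qed

text \<open>
  Differentiability within \<open>I \<times> UNIV \<times> UNIV\<close> may be one-sided in \<open>t\<close>; at a fixed time it is
  two-sided in the remaining arguments.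
\<close>

lemma continuously_differentiable_on_slice:
  fixes F :: "real \<Rightarrow> real \<Rightarrow> real \<Rightarrow> real"
  assumes F: "continuously_differentiable_on (\<lambda>(t, x, u). F t x u) (I \<times> UNIV \<times> UNIV)" and t: "t \<in> I"
  obtains D where "((\<lambda>(x, u). F t x u) has_derivative D) (at (p, q))"
proof -
  obtain G where "((\<lambda>(t, x, u). F t x u) has_derivative blinfun_apply (G (t, p, q))) (at (t, p, q) within I \<times> UNIV \<times> UNIV)"
    using F t by (auto simp: continuously_differentiable_on_def)
  then have G: "((\<lambda>(t, x, u). F t x u) has_derivative blinfun_apply (G (t, p, q))) 
      (at (t, (p, q)) within range (\<lambda>z. (t, z)))"
    by (rule has_derivative_subset) (use t in auto)
  have "((\<lambda>z. (t, z)) has_derivative (\<lambda>z. (0, z))) (at (p, q))"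
    by (auto intro!: derivative_eq_intros)
  from diff_chain_within[OF this G]
  have "((\<lambda>(x, u). F t x u) has_derivative (\<lambda>z. blinfun_apply (G (t, p, q)) (0, z))) (at (p, q))"
    by (simp add: comp_def case_prod_unfold)
  then show ?thesis by (rule that)
qed

lemma continuously_differentiable_imp_continuous_on:
  "continuously_differentiable_on F A \<Longrightarrow> continuous_on A F"
  by (auto simp: continuously_differentiable_on_def intro: has_derivative_continuous_on)

lemma set_integrable_running_payoff:
  fixes F :: "real \<Rightarrow> real \<Rightarrow> real \<Rightarrow> real"
  assumes ab: "a \<le> b" and F: "continuous_on ({a..b} \<times> UNIV \<times> UNIV) (\<lambda>(t, x, u). F t x u)"
    and x: "continuous_on {a..b} x" and u: "u \<in> PC a b"
  shows "set_integrable lborel {a<..<b} (\<lambda>t. F t (x t) (u t))"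
proof -
  obtain S where S: "finite S" "continuous_on ({a..b} - S) u" using u by (auto simp: PC_def)
  have "continuous_on ({a..b} - S) (\<lambda>t. (\<lambda>(t, x, u). F t x u) (t, x t, u t))"
    by (rule continuous_on_compose2[OF F])
       (auto intro!: continuous_intros S continuous_on_subset[OF x])
  then have c: "continuous_on ({a..b} - S) (\<lambda>t. F t (x t) (u t))" by simp
  have "bounded (x ` {a..b})" using x by (intro compact_imp_bounded compact_continuous_image) auto
  then obtain M where M: "\<And>t. t \<in> {a..b} \<Longrightarrow> \<bar>x t\<bar> \<le> M" by (fastforce simp: bounded_iff)
  obtain N where N: "\<And>t. t \<in> {a..b} \<Longrightarrow> \<bar>u t\<bar> \<le> N" 
    using PC_bounded[OF ab u] by (fastforce simp: bounded_iff)
  have "compact ((\<lambda>(t, x, u). F t x u) ` ({a..b} \<times> {- M..M} \<times> {- N..N}))"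
    by (intro compact_continuous_image continuous_on_subset[OF F] compact_Times) auto
  moreover have "(\<lambda>t. F t (x t) (u t)) ` {a..b} \<subseteq> (\<lambda>(t, x, u). F t x u) ` ({a..b} \<times> {- M..M} \<times> {- N..N})"
  proof
    fix y assume "y \<in> (\<lambda>t. F t (x t) (u t)) ` {a..b}"
    then obtain t where "t \<in> {a..b}" "y = F t (x t) (u t)" by blast
    with M[of t] N[of t] show "y \<in> (\<lambda>(t, x, u). F t x u) ` ({a..b} \<times> {- M..M} \<times> {- N..N})"
      by (intro image_eqI[of _ _ "(t, x t, u t)"]) (auto simp: abs_le_iff)
  qed
  ultimately have "bounded ((\<lambda>t. F t (x t) (u t)) ` {a..b})"
    by (meson bounded_subset compact_imp_bounded)
  from set_integrable_if_continuous_off_finite[OF S(1) c this] show ?thesis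
    by (rule set_integrable_subset) auto
qed

section \<open>Sufficiency of the Pontryagin conditions\<close>

theorem theorem2:
  fixes a b xa :: real
    and \<psi> :: "real \<Rightarrow> real"
    and L f :: "real \<Rightarrow> real \<Rightarrow> real \<Rightarrow> real"
    and x_opt u_opt lam :: "real \<Rightarrow> real"
  assumes "a < b"
    and "continuous_on {0..1} \<psi>"
    and "\<forall>\<alpha>\<in>{0..1}. \<psi> \<alpha> \<ge> 0"
    and "(LBINT \<alpha>=0..1. \<psi> \<alpha>) > 0"
    and "continuously_differentiable_on (\<lambda>(t, x, u). L t x u) ({a..b} \<times> UNIV \<times> UNIV)"
    and "continuously_differentiable_on (\<lambda>(t, x, u). f t x u) ({a..b} \<times> UNIV \<times> UNIV)"
    and "\<forall>t\<in>{a..b}. concave_on UNIV (\<lambda>(x, u). L t x u)"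
    and "\<forall>t\<in>{a..b}. concave_on UNIV (\<lambda>(x, u). f t x u)"
    and "pontryagin_extremal a b \<psi> L f xa x_opt u_opt lam"
    and "\<forall>t\<in>{a..b}. lam t \<ge> 0"
  shows "\<forall>x u. admissible a b \<psi> f xa x u \<longrightarrow>
           objective a b L x_opt u_opt \<ge> objective a b L x u"
proof (intro allI impI)
  fix x u assume adm: "admissible a b \<psi> f xa x u"
  have adm_opt: "admissible a b \<psi> f xa x_opt u_opt" and lam: "lam \<in> PC1 a b"
    using assms(9) by (auto simp: pontryagin_extremal_def)
  \<comment> \<open>Subtracting \<open>R y\<close> leaves the objective at \<open>y\<close> unchanged and makes the comparison pointwise.\<close>
  define R where "R y t = (y t - y a) * distributed_RL_right a b \<psi> lam t
      - lam t * distributed_Caputo_left a b \<psi> y t" for y t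
  have R_int: "set_integrable lborel {a<..<b} (R y)" and R_zero: "(LBINT t:{a<..<b}. R y t) = 0"
    if "y \<in> PC1 a b" for y
    using distributed_integration_by_parts[OF assms(1,2) that lam]
    by (simp_all add: R_def[abs_def] set_integral_diff)
  have L_int: "set_integrable lborel {a<..<b} (\<lambda>t. L t (y t) (v t))" if "admissible a b \<psi> f xa y v" for y v
    using that assms(1) continuously_differentiable_imp_continuous_on[OF assms(5)]
    by (intro set_integrable_running_payoff) (auto simp: admissible_def PC1_def)
  have obj: "objective a b L y v = (LBINT t:{a<..<b}. L t (y t) (v t) - R y t)" if "admissible a b \<psi> f xa y v" for y v
    using R_zero[of y] R_int[of y] L_int[OF that] that assms(1)
    by (simp add: objective_def interval_lebesgue_integral_def set_integral_diff admissible_def)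
  have le: "L t (x t) (u t) - R x t \<le> L t (x_opt t) (u_opt t) - R x_opt t" if t: "t \<in> {a<..<b}" for t
  proof -
    have t': "t \<in> {a..b}" using t by simp
    define Lx where "Lx = deriv (\<lambda>y. L t y (u_opt t)) (x_opt t)"
    define Lu where "Lu = deriv (\<lambda>v. L t (x_opt t) v) (u_opt t)"
    define fx where "fx = deriv (\<lambda>y. f t y (u_opt t)) (x_opt t)"
    define fu where "fu = deriv (\<lambda>v. f t (x_opt t) v) (u_opt t)"
    define dx where "dx = x t - x_opt t"
    define du where "du = u t - u_opt t"
    have stat: "Lu + lam t * fu = 0" and costate: "distributed_RL_right a b \<psi> lam t = Lx + lam t * fx"
      using assms(9) t' by (auto simp: pontryagin_extremal_def Lx_def Lu_def fx_def fu_def)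
    obtain D1 where "((\<lambda>(x, u). L t x u) has_derivative D1) (at (x_opt t, u_opt t))"
      by (rule continuously_differentiable_on_slice[OF assms(5) t'])
    then have L_le: "L t (x t) (u t) - L t (x_opt t) (u_opt t) \<le> Lx * dx + Lu * du"
      unfolding Lx_def Lu_def dx_def du_def using assms(7) t' by (intro concave_on_gradient_inequality) auto
    obtain D2 where "((\<lambda>(x, u). f t x u) has_derivative D2) (at (x_opt t, u_opt t))"
      by (rule continuously_differentiable_on_slice[OF assms(6) t'])
    then have "f t (x t) (u t) - f t (x_opt t) (u_opt t) \<le> fx * dx + fu * du"
      unfolding fx_def fu_def dx_def du_def using assms(8) t' by (intro concave_on_gradient_inequality) auto
    then have f_le: "lam t * (f t (x t) (u t) - f t (x_opt t) (u_opt t)) \<le> lam t * (fx * dx + fu * du)"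
      using assms(10) t' by (intro mult_left_mono) auto
    have "Lx * dx + Lu * du = (Lx + lam t * fx) * dx - lam t * (fx * dx + fu * du)"
    proof -
      have "Lu = - (lam t * fu)" using stat by simp
      then show ?thesis by (simp add: algebra_simps)
    qed
    with L_le f_le have "L t (x t) (u t) - L t (x_opt t) (u_opt t) \<le>
        (Lx + lam t * fx) * dx - lam t * (f t (x t) (u t) - f t (x_opt t) (u_opt t))"
      by linarith
    also have "\<dots> = R x t - R x_opt t"
      using adm adm_opt t' by (simp add: R_def costate dx_def admissible_def algebra_simps)
    finally show ?thesis by simp
  qed
  have "(LBINT t:{a<..<b}. L t (x t) (u t) - R x t) \<le> (LBINT t:{a<..<b}. L t (x_opt t) (u_opt t) - R x_opt t)"
    using adm adm_opt le
    by (intro set_integral_mono set_integral_diff(1) L_int R_int) (auto simp: admissible_def)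
  then show "objective a b L x_opt u_opt \<ge> objective a b L x u"
    by (simp add: obj adm adm_opt)
qed

end
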